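(* Let $(p,q)$ and $(r,s)$ be pairs of coprime integers such that $\frac pq$ and $\frac rs$ are distinct points of $\bar{\mathbb Q}=\mathbb Q\cup\{\infty\}$. Then the lambda length $\lambda$ of the pair of horocycles in the Farey decoration with centers $\frac pq$ and $\frac rs$ is given by $\lambda=|ps-qr|$.
   Context: Work in the upper half-plane model $\mathcal U=\{x+iy\in\mathbb C: y>0\}$ of the hyperbolic plane. A horocycle centered at $x\in\mathbb R$ is a Euclidean circle tangent to $\mathbb R$ at $x$ (with the tangency point removed); a horocycle centered at $\infty$ is a horizontal line $\{y=c\}$ with $c>0$. The convention $\infty=\pm\frac10$ is used. The Farey decoration is the family of horocycles, one centered at each point of $\bar{\mathbb Q}=\mathbb Q\cup\{\infty\}$, in which the horocycle centered at $\frac pq\in\mathbb Q$ (in reduced form) has Euclidean diameter $\frac1{q^2}$ and the horocycle centered at $\infty$ is $\{y=1\}$. The lambda length of two horocycles $h,h'$ with distinct centers is $\lambda(h,h')=\exp(\delta/2)$, where $\delta$ is the signed hyperbolic distance (curvature $-1$) between $h$ and $h'$ along the geodesic connecting their centers, taken with positive sign if and only if the horocycles are disjoint. *)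

theory Defs
  imports "HOL-Analysis.Analysis"
begin

text \<open>A line together with one point at infinity: \<^typ>\<open>real\<close> gives the ideal boundary of the upper
  half-plane, \<^typ>\<open>rat\<close> gives the completed rationals.\<close>

datatype 'a completed = Fin 'a | Infty

text \<open>The point p/q, with the convention p/0 = Infty (used for coprime p, q, where q = 0 forces
  p = 1 or p = -1).\<close>

definition frac_point :: "int \<Rightarrow> int \<Rightarrow> rat completed" where
  "frac_point p q = (if q = 0 then Infty else Fin (of_int p / of_int q))"

definition upper_half_plane :: "complex set" where
  "upper_half_plane = {z. 0 < Im z}"


text \<open>The hyperbolic metric is |dz| / Im z (curvature -1), and the distance is the infimum of the
  lengths of piecewise C1 paths.  The condition \<^const>\<open>has_integral\<close> discards paths
  of infinite length: \<^const>\<open>valid_path\<close> allows the speed to blow up at finitely many parameters.\<close>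

definition has_hyp_length :: "(real \<Rightarrow> complex) \<Rightarrow> real \<Rightarrow> bool" where
  "has_hyp_length \<gamma> L \<longleftrightarrow>
     ((\<lambda>t. norm (vector_derivative \<gamma> (at t)) / Im (\<gamma> t)) has_integral L) {0..1}"

definition hyp_dist :: "complex \<Rightarrow> complex \<Rightarrow> real" where
  "hyp_dist z w = Inf {L. \<exists>\<gamma>. valid_path \<gamma> \<and> path_image \<gamma> \<subseteq> upper_half_plane \<and>
                          pathstart \<gamma> = z \<and> pathfinish \<gamma> = w \<and> has_hyp_length \<gamma> L}"

text \<open>The geodesic with two given distinct ideal endpoints; \<^term>\<open>geodesic Infty Infty\<close> is
  a dummy value.\<close>

fun geodesic :: "real completed \<Rightarrow> real completed \<Rightarrow> complex set" where
  "geodesic (Fin x) (Fin y) =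
     sphere (complex_of_real ((x + y) / 2)) (\<bar>x - y\<bar> / 2) \<inter> upper_half_plane"
| "geodesic (Fin x) Infty = {z. Re z = x} \<inter> upper_half_plane"
| "geodesic Infty (Fin x) = {z. Re z = x} \<inter> upper_half_plane"
| "geodesic Infty Infty = {}"


text \<open>The real parameter of a horocycle is the Euclidean diameter for a
  finite center and the height for the center Infty.\<close>

fun horocycle :: "real completed \<Rightarrow> real \<Rightarrow> complex set" where
  "horocycle (Fin x) d = sphere (Complex x (d / 2)) (d / 2) - {complex_of_real x}"
| "horocycle Infty c = {z. Im z = c}"

definition horocycle_centered_at :: "real completed \<Rightarrow> complex set \<Rightarrow> bool" where
  "horocycle_centered_at x h \<longleftrightarrow> (\<exists>d>0. h = horocycle x d)"

definition horocycle_center :: "complex set \<Rightarrow> real completed" where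
  "horocycle_center h = (THE x. horocycle_centered_at x h)"

text \<open>A horocycle meets each geodesic ending at its center in exactly one point; the distance along
  the geodesic joining the centers is the distance between the two points so obtained.\<close>

definition signed_dist :: "complex set \<Rightarrow> complex set \<Rightarrow> real" where
  "signed_dist h h' =
     (let g = geodesic (horocycle_center h) (horocycle_center h');
          u = (THE z. z \<in> h \<inter> g);
          v = (THE z. z \<in> h' \<inter> g)
      in (if h \<inter> h' = {} then hyp_dist u v else - hyp_dist u v))"

definition lambda_length :: "complex set \<Rightarrow> complex set \<Rightarrow> real" where
  "lambda_length h h' = exp (signed_dist h h' / 2)"


text \<open>\<^const>\<open>quotient_of\<close> yields the reduced form of a rational number.\<close>

fun farey_decoration :: "rat completed \<Rightarrow> complex set" where
  "farey_decoration (Fin a) =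
     horocycle (Fin (of_rat a)) (1 / (of_int (snd (quotient_of a)))\<^sup>2)"
| "farey_decoration Infty = horocycle Infty 1"

end

theory Submission
  imports Defs "HOL-Complex_Analysis.Contour_Integration"
begin

text \<open>
  Two horocycles with finite centers \<open>x \<noteq> y\<close> and Euclidean diameters \<open>d\<close>, \<open>e\<close> that are disjoint or
  tangent have lambda length \<open>\<bar>x - y\<bar> / sqrt (d * e)\<close>; for centers \<open>x\<close> and \<open>Infty\<close>, diameter \<open>d\<close> and
  height \<open>c \<ge> d\<close> it is \<open>sqrt (c / d)\<close>.  In the Farey decoration \<open>d = 1/q\<^sup>2\<close> and \<open>e = 1/s\<^sup>2\<close>, and
  \<open>x - y = (p s - q r) / (q s)\<close>, so the first formula gives \<open>\<bar>p s - q r\<bar>\<close>;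
  for the centers \<open>p/q\<close> and \<open>\<plusminus>1/0\<close> the second one, with \<open>c = 1\<close>, gives \<open>\<bar>q\<bar>\<close>.  Since
  \<open>p s - q r\<close> is a nonzero integer, any two of the horocycles are indeed disjoint or tangent.

  The distance behind the first formula is read off from the parameter \<open>\<tau>\<close> on the semicircle from
  \<open>x\<close> to \<open>y\<close> for which the Moebius map \<open>z \<mapsto> (z - x) / (y - z)\<close> takes the value \<open>\<i> \<tau>\<close>.  In it,
  the points on the two horocycles are \<open>\<tau> = d / (y - x)\<close> and \<open>\<tau> = (y - x) / e\<close>
  (\<open>horocycle_Int_semicircle\<close>), and hyperbolic distance is the difference of the values of
  \<open>ln \<bar>\<tau>\<bar>\<close> (\<open>hyp_dist_semicircle\<close>), here \<open>ln ((x - y)\<^sup>2 / (d * e))\<close>.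

  Because the distance is an infimum over all paths, a lower bound for every path is needed.  It
  comes from a calibration: a holomorphic \<open>F\<close> with \<open>\<bar>F' z\<bar> \<le> 1 / Im z\<close> on the half-plane cannot
  change along a path by more than the hyperbolic length of that path, and equality of
  the gain in \<open>Re F\<close> and the length for one explicit path shows that this path is shortest.  The calibrations
  are \<open>Ln (z - x)\<close> for a vertical line and \<open>Ln (z - x) - Ln (z - y)\<close> for a semicircle.
\<close>

section \<open>Hyperbolic distance along a geodesic\<close>

text \<open>Integrating \<open>F'\<close> along \<open>\<gamma>\<close> yields the difference of the end values of \<open>F\<close>, and the bound on
  \<open>F'\<close> makes the integrand at most the hyperbolic speed of \<open>\<gamma>\<close>.\<close>

lemma calibration_le_hyp_length:
  assumes F: "\<And>z. z \<in> upper_half_plane \<Longrightarrow> (F has_field_derivative F' z) (at z)"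
    and F'_le: "\<And>z. z \<in> upper_half_plane \<Longrightarrow> norm (F' z) \<le> 1 / Im z"
    and \<gamma>: "valid_path \<gamma>" "path_image \<gamma> \<subseteq> upper_half_plane"
    and L: "has_hyp_length \<gamma> L"
  shows "norm (F (pathfinish \<gamma>) - F (pathstart \<gamma>)) \<le> L"
proof -
  have "(F' has_contour_integral (F (pathfinish \<gamma>) - F (pathstart \<gamma>))) \<gamma>"
    by (rule contour_integral_primitive[OF _ \<gamma>]) (auto intro: has_field_derivative_at_within F)
  then have I: "((\<lambda>t. F' (\<gamma> t) * vector_derivative \<gamma> (at t)) has_integral
      (F (pathfinish \<gamma>) - F (pathstart \<gamma>))) {0..1}"
    by (simp add: has_contour_integral)
  have "norm (F' (\<gamma> t) * vector_derivative \<gamma> (at t)) \<le> norm (vector_derivative \<gamma> (at t)) / Im (\<gamma> t)"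
    if "t \<in> {0..1}" for t
  proof -
    have "\<gamma> t \<in> upper_half_plane"
      using that \<gamma>(2) by (auto simp: path_image_def)
    from mult_right_mono[OF F'_le[OF this], of "norm (vector_derivative \<gamma> (at t))"]
    show ?thesis by (simp add: norm_mult)
  qed
  then show ?thesis
    using integral_norm_bound_integral[OF has_integral_integrable[OF I]
        has_integral_integrable[OF L[unfolded has_hyp_length_def]]]
      integral_unique[OF I] integral_unique[OF L[unfolded has_hyp_length_def]] by auto
qed

text \<open>The path \<open>\<gamma>\<close> has constant hyperbolic speed \<open>c\<close> on the unit interval, so its length is \<open>c\<close>;
  every competitor has at least this length because \<open>Re F\<close> changes by \<open>c\<close> between the endpoints.\<close>

lemma hyp_dist_eqI:
  assumes F: "\<And>z. z \<in> upper_half_plane \<Longrightarrow> (F has_field_derivative F' z) (at z)"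
    and F'_le: "\<And>z. z \<in> upper_half_plane \<Longrightarrow> norm (F' z) \<le> 1 / Im z"
    and \<gamma>': "\<And>t. (\<gamma> has_vector_derivative \<gamma>' t) (at t)"
    and cont: "continuous_on {0..1} \<gamma>'"
    and upper: "\<And>t. t \<in> {0..1} \<Longrightarrow> \<gamma> t \<in> upper_half_plane"
    and speed: "\<And>t. t \<in> {0..1} \<Longrightarrow> norm (\<gamma>' t) = c * Im (\<gamma> t)"
    and gain: "\<bar>Re (F (\<gamma> 1)) - Re (F (\<gamma> 0))\<bar> = c"
  shows "hyp_dist (\<gamma> 0) (\<gamma> 1) = c"
  unfolding hyp_dist_def
proof (rule cInf_eq_minimum)
  have "\<gamma> C1_differentiable_on {0..1}"
    using \<gamma>' cont by (auto simp: C1_differentiable_on_def)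
  then have "valid_path \<gamma>"
    by (simp add: valid_path_def C1_differentiable_imp_piecewise)
  moreover have "has_hyp_length \<gamma> c"
    unfolding has_hyp_length_def
  proof (rule has_integral_eq)
    show "((\<lambda>t. c) has_integral c) {0..1::real}"
      using has_integral_const_real[of c 0 1] by simp
    show "c = norm (vector_derivative \<gamma> (at t)) / Im (\<gamma> t)" if "t \<in> {0..1}" for t
      using vector_derivative_at[OF \<gamma>'] speed[OF that] upper[OF that]
      by (simp add: upper_half_plane_def)
  qed
  ultimately show "c \<in> {L. \<exists>\<gamma>'. valid_path \<gamma>' \<and> path_image \<gamma>' \<subseteq> upper_half_plane \<and>
      pathstart \<gamma>' = \<gamma> 0 \<and> pathfinish \<gamma>' = \<gamma> 1 \<and> has_hyp_length \<gamma>' L}"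
    using upper by (auto simp: path_image_def pathstart_def pathfinish_def)
next
  fix L
  assume "L \<in> {L. \<exists>\<gamma>'. valid_path \<gamma>' \<and> path_image \<gamma>' \<subseteq> upper_half_plane \<and>
      pathstart \<gamma>' = \<gamma> 0 \<and> pathfinish \<gamma>' = \<gamma> 1 \<and> has_hyp_length \<gamma>' L}"
  then have "norm (F (\<gamma> 1) - F (\<gamma> 0)) \<le> L"
    using calibration_le_hyp_length[OF F F'_le] by fastforce
  with gain abs_Re_le_cmod[of "F (\<gamma> 1) - F (\<gamma> 0)"] show "c \<le> L"
    by simp
qed

lemma Ln_translate_has_derivative:
  assumes "z \<in> upper_half_plane"
  shows "((\<lambda>z. Ln (z - of_real x)) has_field_derivative 1 / (z - of_real x)) (at z)"
proof -
  have "z - of_real x \<notin> \<real>\<^sub>\<le>\<^sub>0"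
    using assms by (auto simp: upper_half_plane_def complex_nonpos_Reals_iff)
  then show ?thesis
    by (auto intro!: derivative_eq_intros simp: divide_simps)
qed

text \<open>The calibration is \<open>Ln (z - x)\<close>: its derivative has norm \<open>1 / \<bar>z - x\<bar> \<le> 1 / Im z\<close>, and on the
  vertical line through \<open>x\<close> its real part is \<open>ln (Im z)\<close>.\<close>

lemma hyp_dist_vertical:
  assumes "0 < a" "0 < b"
  shows "hyp_dist (Complex x a) (Complex x b) = \<bar>ln b - ln a\<bar>"
proof -
  define l where "l = ln b - ln a"
  define \<gamma> where "\<gamma> = (\<lambda>t. of_real x + \<i> * of_real (a * exp (l * t)))"
  define \<gamma>' where "\<gamma>' = (\<lambda>t. \<i> * of_real (a * (l * exp (l * t))))"
  have ends: "\<gamma> 0 = Complex x a" "\<gamma> 1 = Complex x b"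
    using assms by (auto simp: \<gamma>_def l_def exp_diff complex_eq_iff)
  have "hyp_dist (\<gamma> 0) (\<gamma> 1) = \<bar>l\<bar>"
  proof (rule hyp_dist_eqI)
    fix z assume z: "z \<in> upper_half_plane"
    show "((\<lambda>z. Ln (z - of_real x)) has_field_derivative 1 / (z - of_real x)) (at z)"
      using z by (rule Ln_translate_has_derivative)
    show "norm (1 / (z - of_real x)) \<le> 1 / Im z"
      using z abs_Im_le_cmod[of "z - of_real x"]
      by (auto simp: upper_half_plane_def norm_divide intro!: divide_left_mono mult_pos_pos)
  next
    fix t
    show "(\<gamma> has_vector_derivative \<gamma>' t) (at t)"
      unfolding \<gamma>_def \<gamma>'_def
      by (auto intro!: derivative_eq_intros has_vector_derivative_of_real simp: algebra_simps)
    show "norm (\<gamma>' t) = \<bar>l\<bar> * Im (\<gamma> t)" 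
      using assms by (simp add: \<gamma>_def \<gamma>'_def norm_mult abs_mult)
    show "\<gamma> t \<in> upper_half_plane"
      using assms by (simp add: upper_half_plane_def \<gamma>_def)
  next
    show "continuous_on {0..1} \<gamma>'"
      unfolding \<gamma>'_def by (intro continuous_intros)
    have "Complex x c - of_real x = \<i> * of_real c" for c
      by (simp add: complex_eq_iff)
    then show "\<bar>Re (Ln (\<gamma> 1 - of_real x)) - Re (Ln (\<gamma> 0 - of_real x))\<bar> = \<bar>l\<bar>"
      using assms by (simp add: ends l_def norm_mult)
  qed
  then show ?thesis by (simp add: ends l_def)
qed

text \<open>The point \<open>z\<close> with \<open>(z - x) / (y - z) = \<i> * \<tau>\<close>.  It lies in the upper half-plane iff \<open>\<tau>\<close> has the
  sign of \<open>y - x\<close>, so neither order of \<open>x\<close> and \<open>y\<close> has to be singled out.\<close>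

definition semicircle_point :: "real \<Rightarrow> real \<Rightarrow> real \<Rightarrow> complex" where
  "semicircle_point x y \<tau> =
     (of_real x + of_real y * (\<i> * of_real \<tau>)) / (1 + \<i> * of_real \<tau>)"

lemma one_plus_i_times_nonzero: "1 + \<i> * of_real \<tau> \<noteq> (0::complex)"
  by (simp add: complex_eq_iff)

lemma semicircle_point_minus_left:
  "semicircle_point x y \<tau> - of_real x = of_real (y - x) * (\<i> * of_real \<tau>) / (1 + \<i> * of_real \<tau>)"
  using one_plus_i_times_nonzero[of \<tau>] by (simp add: semicircle_point_def field_simps)

lemma semicircle_point_minus_right:
  "semicircle_point x y \<tau> - of_real y = of_real (x - y) / (1 + \<i> * of_real \<tau>)"
  using one_plus_i_times_nonzero[of \<tau>] by (simp add: semicircle_point_def field_simps)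

lemma Re_semicircle_point: "Re (semicircle_point x y \<tau>) = (x + y * \<tau>\<^sup>2) / (1 + \<tau>\<^sup>2)"
  by (simp add: semicircle_point_def Re_divide power2_eq_square)

lemma Im_semicircle_point: "Im (semicircle_point x y \<tau>) = (y - x) * \<tau> / (1 + \<tau>\<^sup>2)"
  by (simp add: semicircle_point_def Im_divide power2_eq_square algebra_simps)

lemma norm_one_plus_i_times: "(norm (1 + \<i> * of_real \<tau>))\<^sup>2 = 1 + \<tau>\<^sup>2"
  by (simp add: cmod_power2)

text \<open>Both sides measure the triangle \<open>x\<close>, \<open>y\<close>, \<open>z\<close>: twice its area is base times height, and is also
  the product of the other two sides times the sine of the angle between them.  The estimate bounds
  the derivative of the calibration of a semicircle, and it also keeps horocycles with small
  diameters apart.\<close>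

lemma Im_mult_dist_le:
  assumes "z \<in> upper_half_plane"
  shows "\<bar>x - y\<bar> * Im z \<le> norm (z - of_real x) * norm (z - of_real y)"
proof -
  have "(x - y) * Im z = Im ((z - of_real x) * cnj (z - of_real y))"
    by (simp add: algebra_simps)
  then have "\<bar>(x - y) * Im z\<bar> \<le> norm ((z - of_real x) * cnj (z - of_real y))"
    by (metis abs_Im_le_cmod)
  then show ?thesis
    using assms by (simp add: abs_mult norm_mult upper_half_plane_def del: complex_cnj_diff)
qed

text \<open>On the semicircle \<open>\<bar>z - x\<bar> / \<bar>z - y\<bar> = \<bar>\<tau>\<bar>\<close>, so the real part of the calibration
  \<open>Ln (z - x) - Ln (z - y)\<close> is \<open>ln \<bar>\<tau>\<bar>\<close>.  Letting \<open>\<tau>\<close> grow exponentially gives the path of constant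
  hyperbolic speed.\<close>

lemma hyp_dist_semicircle:
  assumes "0 < (y - x) * \<sigma>" "0 < (y - x) * \<tau>"
  shows "hyp_dist (semicircle_point x y \<sigma>) (semicircle_point x y \<tau>) = \<bar>ln \<bar>\<tau>\<bar> - ln \<bar>\<sigma>\<bar>\<bar>"
proof -
  define l where "l = ln \<bar>\<tau>\<bar> - ln \<bar>\<sigma>\<bar>"
  define w where "w = (\<lambda>t. \<sigma> * exp (l * t))"
  define \<gamma> where "\<gamma> = (\<lambda>t. semicircle_point x y (w t))"
  define \<gamma>' where "\<gamma>' = (\<lambda>t. of_real (y - x) * \<i> * of_real (l * w t) / (1 + \<i> * of_real (w t))\<^sup>2)"
  have nz: "x \<noteq> y" "\<sigma> \<noteq> 0" "\<tau> \<noteq> 0"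
    using assms by auto
  have "\<tau> / \<sigma> = \<bar>\<tau>\<bar> / \<bar>\<sigma>\<bar>"
    using assms by (auto simp: zero_less_mult_iff)
  then have "\<sigma> * (\<bar>\<tau>\<bar> / \<bar>\<sigma>\<bar>) = \<tau>"
    using nz by (metis nonzero_mult_div_cancel_left times_divide_eq_right)
  then have ends: "\<gamma> 0 = semicircle_point x y \<sigma>" "\<gamma> 1 = semicircle_point x y \<tau>"
    using nz by (auto simp: \<gamma>_def w_def l_def exp_diff)
  have pos: "0 < (y - x) * w t" for t
    using assms(1) by (simp add: w_def mult.assoc[symmetric])
  have upper: "\<gamma> t \<in> upper_half_plane" for t
    using pos[of t] by (simp add: \<gamma>_def upper_half_plane_def Im_semicircle_point add_pos_nonneg)
  have "hyp_dist (\<gamma> 0) (\<gamma> 1) = \<bar>l\<bar>"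
  proof (rule hyp_dist_eqI)
    fix z assume z: "z \<in> upper_half_plane"
    show "((\<lambda>z. Ln (z - of_real x) - Ln (z - of_real y)) has_field_derivative
        1 / (z - of_real x) - 1 / (z - of_real y)) (at z)"
      by (intro DERIV_diff Ln_translate_has_derivative z)
    have ne: "z - of_real x \<noteq> 0" "z - of_real y \<noteq> 0"
      using z by (auto simp: upper_half_plane_def complex_eq_iff)
    then have "1 / (z - of_real x) - 1 / (z - of_real y) =
        of_real (x - y) / ((z - of_real x) * (z - of_real y))"
      by (simp add: divide_simps)
    then have "norm (1 / (z - of_real x) - 1 / (z - of_real y)) =
        \<bar>x - y\<bar> / (norm (z - of_real x) * norm (z - of_real y))"
      by (simp only: norm_divide norm_mult norm_of_real)
    also have "\<dots> \<le> 1 / Im z"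
      using Im_mult_dist_le[OF z, of x y] ne z
      by (simp add: divide_simps upper_half_plane_def mult.commute)
    finally show "norm (1 / (z - of_real x) - 1 / (z - of_real y)) \<le> 1 / Im z" .
  next
    fix t
    have w': "((\<lambda>t. complex_of_real (w t)) has_vector_derivative of_real (l * w t)) (at t)"
      unfolding w_def by (auto intro!: derivative_eq_intros has_vector_derivative_of_real)
    have "((\<lambda>s. (of_real x + of_real y * (\<i> * s)) / (1 + \<i> * s)) has_field_derivative
        of_real (y - x) * \<i> / (1 + \<i> * of_real (w t))\<^sup>2) (at (of_real (w t)))"
      using one_plus_i_times_nonzero[of "w t"]
      by (auto intro!: derivative_eq_intros simp: power2_eq_square algebra_simps divide_simps)
    from field_vector_diff_chain_at[OF w' this]
    show "(\<gamma> has_vector_derivative \<gamma>' t) (at t)"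
      by (simp add: \<gamma>_def \<gamma>'_def semicircle_point_def o_def mult_ac)
    show "norm (\<gamma>' t) = \<bar>l\<bar> * Im (\<gamma> t)"
    proof -
      have "norm (\<gamma>' t) = \<bar>l\<bar> * \<bar>(y - x) * w t\<bar> / (1 + (w t)\<^sup>2)"
        unfolding \<gamma>'_def
        by (simp only: norm_divide norm_mult norm_power norm_one_plus_i_times norm_of_real norm_ii
            abs_mult mult_ac mult_1_right)
      then show ?thesis
        using pos[of t] by (simp add: \<gamma>_def Im_semicircle_point)
    qed
  next
    show "continuous_on {0..1} \<gamma>'"
      unfolding \<gamma>'_def w_def using one_plus_i_times_nonzero
      by (intro continuous_intros ballI) (metis power_not_zero)
    have "Re (Ln (semicircle_point x y \<rho> - of_real x) - Ln (semicircle_point x y \<rho> - of_real y))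
        = ln \<bar>\<rho>\<bar>" if "\<rho> \<noteq> 0" for \<rho>
    proof -
      have "norm (semicircle_point x y \<rho> - of_real x) =
          norm (semicircle_point x y \<rho> - of_real y) * \<bar>\<rho>\<bar>"
        unfolding semicircle_point_minus_left semicircle_point_minus_right
        by (simp only: norm_divide norm_mult norm_of_real norm_ii) (simp add: abs_minus_commute)
      moreover have "semicircle_point x y \<rho> - of_real x \<noteq> 0"
          "semicircle_point x y \<rho> - of_real y \<noteq> 0"
        unfolding semicircle_point_minus_left semicircle_point_minus_right
        using nz that one_plus_i_times_nonzero[of \<rho>] by simp_all
      ultimately show ?thesis
        using that by (simp add: ln_mult)
    qed
    then show "\<bar>Re (Ln (\<gamma> 1 - of_real x) - Ln (\<gamma> 1 - of_real y)) -
        Re (Ln (\<gamma> 0 - of_real x) - Ln (\<gamma> 0 - of_real y))\<bar> = \<bar>l\<bar>"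
      using nz by (simp only: ends l_def not_False_eq_True)
  qed (use upper in auto)
  then show ?thesis by (simp add: ends l_def)
qed

section \<open>Horocycles and geodesics\<close>

lemma mem_horocycle_Fin:
  assumes "0 < d"
  shows "z \<in> horocycle (Fin x) d \<longleftrightarrow> 0 < Im z \<and> (Re z - x)\<^sup>2 + (Im z)\<^sup>2 = d * Im z"
proof -
  have "z \<in> sphere (Complex x (d / 2)) (d / 2) \<longleftrightarrow>
      (norm (Complex x (d / 2) - z))\<^sup>2 = (d / 2)\<^sup>2"
    using assms power2_eq_iff_nonneg[of "norm (Complex x (d / 2) - z)" "d / 2"]
    by (simp add: dist_norm del: power2_eq_iff_nonneg)
  also have "\<dots> \<longleftrightarrow> (Re z - x)\<^sup>2 + (Im z)\<^sup>2 = d * Im z"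
    unfolding cmod_power2 by (simp add: power2_eq_square field_simps) argo
  finally have sph: "z \<in> sphere (Complex x (d / 2)) (d / 2) \<longleftrightarrow>
      (Re z - x)\<^sup>2 + (Im z)\<^sup>2 = d * Im z" .
  have "z \<noteq> of_real x \<longleftrightarrow> 0 < Im z" if eq: "(Re z - x)\<^sup>2 + (Im z)\<^sup>2 = d * Im z"
  proof -
    have "0 \<le> d * Im z"
      using eq by (metis sum_power2_ge_zero)
    then have "0 \<le> Im z"
      using assms by (simp add: zero_le_mult_iff)
    moreover have "Im z = 0 \<longleftrightarrow> z = of_real x"
      using eq by (auto simp: complex_eq_iff)
    ultimately show ?thesis by auto
  qed
  with sph show ?thesis by auto
qed

text \<open>The highest point \<open>x + \<i> d\<close> of a horocycle at a finite center determines the center: if it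
  lies on the horocycle \<open>(y, e)\<close> as well, then \<open>(x - y)\<^sup>2 = (e - d) * d\<close>, hence \<open>d \<le> e\<close>, and by
  symmetry \<open>d = e\<close> and \<open>x = y\<close>.\<close>

lemma horocycle_inject:
  assumes "0 < d" "0 < e" and eq: "horocycle x d = horocycle y e"
  shows "x = y"
proof -
  have top: "x' = y' \<and> d' = e' \<or> d' < e'"
    if "0 < d'" "0 < e'" "horocycle (Fin x') d' = horocycle (Fin y') e'" for x' y' d' e' :: real
  proof -
    have "Complex x' d' \<in> horocycle (Fin x') d'"
      using that(1) by (simp add: mem_horocycle_Fin power2_eq_square del: horocycle.simps)
    then have "Complex x' d' \<in> horocycle (Fin y') e'"
      using that(3) by blast
    then have "(x' - y')\<^sup>2 + d'\<^sup>2 = e' * d'"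
      using that(2) by (simp add: mem_horocycle_Fin del: horocycle.simps)
    then have *: "(x' - y')\<^sup>2 = (e' - d') * d'"
      by (simp add: power2_eq_square algebra_simps)
    then have "0 \<le> (e' - d') * d'"
      by (metis zero_le_power2)
    then have "d' \<le> e'"
      using that by (simp add: zero_le_mult_iff)
    with * show ?thesis by (cases "d' = e'") auto
  qed
  \<comment> \<open>A horizontal line cannot contain both the highest and the rightmost point of a circle.\<close>
  have no: False if "0 < d'" "horocycle (Fin x') d' = horocycle Infty c" for x' d' c :: real
  proof -
    have "Complex x' d' \<in> horocycle (Fin x') d'" "Complex (x' + d' / 2) (d' / 2) \<in> horocycle (Fin x') d'"
      using that(1) by (auto simp: mem_horocycle_Fin power2_eq_square simp del: horocycle.simps)
    then show False
      using that by (auto simp del: horocycle.simps(1))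
  qed
  show ?thesis
    using assms(1,2) eq top[of d e] top[of e d] no[of d] no[of e]
    by (cases x; cases y) (metis less_asym)+
qed

lemma horocycle_center_horocycle:
  assumes "0 < d"
  shows "horocycle_center (horocycle x d) = x"
  unfolding horocycle_center_def horocycle_centered_at_def
  using assms horocycle_inject by (intro the_equality) blast+

lemma semicircle_eq_range:
  assumes "x \<noteq> y"
  shows "geodesic (Fin x) (Fin y) = semicircle_point x y ` {\<tau>. 0 < (y - x) * \<tau>}"
proof -
  have mem: "z \<in> geodesic (Fin x) (Fin y) \<longleftrightarrow> 0 < Im z \<and> (Re z - x) * (y - Re z) = (Im z)\<^sup>2" for z
  proof -
    have "z \<in> sphere (complex_of_real ((x + y) / 2)) (\<bar>x - y\<bar> / 2) \<longleftrightarrow>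
        (norm (of_real ((x + y) / 2) - z))\<^sup>2 = (\<bar>x - y\<bar> / 2)\<^sup>2"
      by (simp add: dist_norm del: of_real_divide of_real_add)
    also have "\<dots> \<longleftrightarrow> (Re z - x) * (y - Re z) = (Im z)\<^sup>2"
      unfolding cmod_power2 by (simp add: power2_eq_square field_simps) argo
    finally show ?thesis
      unfolding geodesic.simps Int_iff upper_half_plane_def mem_Collect_eq by blast
  qed
  show ?thesis
  proof (intro equalityI subsetI)
    fix z assume "z \<in> geodesic (Fin x) (Fin y)"
    then have b: "0 < Im z" and eq: "(Re z - x) * (y - Re z) = (Im z)\<^sup>2"
      unfolding mem by auto
    define \<tau> where "\<tau> = (Re z - x) / Im z"
    have re: "Re z = x + \<tau> * Im z"
      using b by (simp add: \<tau>_def)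
    have im: "Im z = \<tau> * (y - Re z)"
      using b eq by (simp add: \<tau>_def field_simps power2_eq_square)
    have "z - of_real x = \<i> * of_real \<tau> * (of_real y - z)"
      using re im by (simp add: complex_eq_iff)
    then have "z * (1 + \<i> * of_real \<tau>) = of_real x + of_real y * (\<i> * of_real \<tau>)"
      by (simp add: algebra_simps)
    then have "z = semicircle_point x y \<tau>"
      using one_plus_i_times_nonzero[of \<tau>] by (simp add: semicircle_point_def eq_divide_eq)
    moreover from this b have "0 < (y - x) * \<tau>"
      using add_pos_nonneg[OF zero_less_one zero_le_power2, of \<tau>]
      by (auto simp: Im_semicircle_point zero_less_divide_iff)
    ultimately show "z \<in> semicircle_point x y ` {\<tau>. 0 < (y - x) * \<tau>}" by blast
  next
    fix z assume "z \<in> semicircle_point x y ` {\<tau>. 0 < (y - x) * \<tau>}"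
    then obtain \<tau> where \<tau>: "0 < (y - x) * \<tau>" and z: "z = semicircle_point x y \<tau>" by auto
    have nz: "1 + \<tau>\<^sup>2 \<noteq> 0" "0 < 1 + \<tau>\<^sup>2" by (auto simp: add_pos_nonneg add_nonneg_eq_0_iff)
    have "Re z - x = (y - x) * \<tau>\<^sup>2 / (1 + \<tau>\<^sup>2)" "y - Re z = (y - x) / (1 + \<tau>\<^sup>2)"
      using nz by (auto simp: z Re_semicircle_point field_simps)
    then have "(Re z - x) * (y - Re z) = (Im z)\<^sup>2"
      by (simp add: z Im_semicircle_point power2_eq_square)
    then show "z \<in> geodesic (Fin x) (Fin y)"
      using \<tau> nz unfolding mem by (simp add: z Im_semicircle_point)
  qed
qed

lemma semicircle_point_mem_horocycle_left:
  assumes "0 < d" "0 < (y - x) * \<tau>"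
  shows "semicircle_point x y \<tau> \<in> horocycle (Fin x) d \<longleftrightarrow> \<tau> = d / (y - x)"
proof -
  let ?z = "semicircle_point x y \<tau>"
  have pos: "0 < 1 + \<tau>\<^sup>2" by (simp add: add_pos_nonneg)
  define k where "k = (y - x) * \<tau> / (1 + \<tau>\<^sup>2)"
  have "0 < k"
    unfolding k_def using assms(2) pos by (rule divide_pos_pos)
  have im: "Im ?z = k"
    by (simp add: k_def Im_semicircle_point)
  have re: "Re ?z - x = k * \<tau>"
    using pos by (simp add: k_def Re_semicircle_point field_simps power2_eq_square)
  have "(k * \<tau>)\<^sup>2 + k\<^sup>2 = k * (k * (1 + \<tau>\<^sup>2))"
    by (simp add: power2_eq_square algebra_simps)
  also have "k * (1 + \<tau>\<^sup>2) = (y - x) * \<tau>"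
    using pos by (simp add: k_def)
  finally have "?z \<in> horocycle (Fin x) d \<longleftrightarrow> k * ((y - x) * \<tau>) = d * k"
    using assms(1) \<open>0 < k\<close> by (simp only: mem_horocycle_Fin re im simp_thms)
  also have "\<dots> \<longleftrightarrow> k * (\<tau> * (y - x)) = k * d"
    by (simp only: mult_ac)
  also have "\<dots> \<longleftrightarrow> \<tau> * (y - x) = d"
    using \<open>0 < k\<close> by (subst mult_left_cancel) auto
  also have "\<dots> \<longleftrightarrow> \<tau> = d / (y - x)"
    using assms(2) by (subst eq_divide_eq) auto
  finally show ?thesis .
qed

lemma semicircle_point_mem_horocycle_right:
  assumes "0 < e" "0 < (y - x) * \<tau>"
  shows "semicircle_point x y \<tau> \<in> horocycle (Fin y) e \<longleftrightarrow> \<tau> = (y - x) / e"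
proof -
  let ?z = "semicircle_point x y \<tau>"
  have pos: "0 < 1 + \<tau>\<^sup>2" by (simp add: add_pos_nonneg)
  define k where "k = (y - x) / (1 + \<tau>\<^sup>2)"
  have "0 < (y - x) * \<tau> / (1 + \<tau>\<^sup>2)"
    using assms(2) pos by (rule divide_pos_pos)
  then have "0 < k * \<tau>"
    by (simp add: k_def)
  then have "k \<noteq> 0" by auto
  have im: "Im ?z = k * \<tau>"
    by (simp add: k_def Im_semicircle_point)
  have re: "Re ?z - y = - k"
    using pos by (simp add: k_def Re_semicircle_point field_simps power2_eq_square)
  have "(- k)\<^sup>2 + (k * \<tau>)\<^sup>2 = k * (k * (1 + \<tau>\<^sup>2))"
    by (simp add: power2_eq_square algebra_simps)
  also have "k * (1 + \<tau>\<^sup>2) = y - x"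
    using pos by (simp add: k_def)
  finally have "?z \<in> horocycle (Fin y) e \<longleftrightarrow> k * (y - x) = e * (k * \<tau>)"
    using assms(1) \<open>0 < k * \<tau>\<close> by (simp only: mem_horocycle_Fin re im simp_thms)
  also have "\<dots> \<longleftrightarrow> k * (\<tau> * e) = k * (y - x)"
    by (simp only: mult_ac) (rule eq_commute)
  also have "\<dots> \<longleftrightarrow> \<tau> * e = y - x"
    using \<open>k \<noteq> 0\<close> by (subst mult_left_cancel) auto
  also have "\<dots> \<longleftrightarrow> \<tau> = (y - x) / e"
    using assms(1) by (subst eq_divide_eq) auto
  finally show ?thesis .
qed

lemma horocycle_Int_semicircle:
  assumes "x \<noteq> y" "0 < d" "0 < e"
  shows "horocycle (Fin x) d \<inter> geodesic (Fin x) (Fin y) = {semicircle_point x y (d / (y - x))}"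
    and "horocycle (Fin y) e \<inter> geodesic (Fin x) (Fin y) = {semicircle_point x y ((y - x) / e)}"
proof -
  have "0 < (y - x) * (d / (y - x))" "0 < (y - x) * ((y - x) / e)"
    using assms by (auto simp: zero_less_mult_iff zero_less_divide_iff)
  then show "horocycle (Fin x) d \<inter> geodesic (Fin x) (Fin y) = {semicircle_point x y (d / (y - x))}"
      "horocycle (Fin y) e \<inter> geodesic (Fin x) (Fin y) = {semicircle_point x y ((y - x) / e)}"
    unfolding semicircle_eq_range[OF assms(1)]
    using semicircle_point_mem_horocycle_left[OF assms(2), of y x]
      semicircle_point_mem_horocycle_right[OF assms(3), of y x]
    by blast+
qed

lemma horocycle_Int_vertical:
  assumes "0 < d" "0 < c"
  shows "horocycle (Fin x) d \<inter> geodesic (Fin x) Infty = {Complex x d}"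
    and "horocycle Infty c \<inter> geodesic (Fin x) Infty = {Complex x c}"
  using assms by (auto simp: mem_horocycle_Fin upper_half_plane_def complex_eq_iff power2_eq_square
      simp del: horocycle.simps(1))

text \<open>A common point \<open>z\<close> satisfies \<open>\<bar>z - x\<bar>\<^sup>2 = d * Im z\<close> and \<open>\<bar>z - y\<bar>\<^sup>2 = e * Im z\<close>, and the triangle
  estimate \<open>Im_mult_dist_le\<close> turns the product of the two into \<open>(x - y)\<^sup>2 \<le> d * e\<close>.\<close>

lemma disjoint_horocycles_Fin:
  assumes "0 < d" "0 < e" "d * e < (x - y)\<^sup>2"
  shows "horocycle (Fin x) d \<inter> horocycle (Fin y) e = {}"
proof (rule ccontr)
  assume "\<not> ?thesis"
  then obtain z where "z \<in> horocycle (Fin x) d" "z \<in> horocycle (Fin y) e" by blast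
  then have z: "0 < Im z" "(norm (z - of_real x))\<^sup>2 = d * Im z" "(norm (z - of_real y))\<^sup>2 = e * Im z"
    using assms(1,2) by (simp_all add: mem_horocycle_Fin cmod_power2 del: horocycle.simps)
  have "(\<bar>x - y\<bar> * Im z)\<^sup>2 \<le> (norm (z - of_real x) * norm (z - of_real y))\<^sup>2"
    using z(1) by (intro power_mono Im_mult_dist_le) (auto simp: upper_half_plane_def)
  also have "\<dots> = d * e * (Im z)\<^sup>2"
    unfolding power_mult_distrib z(2,3) by (simp add: power2_eq_square)
  finally have "(x - y)\<^sup>2 \<le> d * e"
    using z(1) by (simp add: power_mult_distrib)
  with assms(3) show False by simp
qed

lemma disjoint_horocycles_Infty:
  assumes "0 < d" "d < c"
  shows "horocycle (Fin x) d \<inter> horocycle Infty c = {}"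
proof (rule ccontr)
  assume "\<not> ?thesis"
  then obtain z where z: "z \<in> horocycle (Fin x) d" "Im z = c"
    by (auto simp del: horocycle.simps(1))
  then have "(Re z - x)\<^sup>2 = (d - c) * c"
    using assms(1) by (simp add: mem_horocycle_Fin power2_eq_square algebra_simps del: horocycle.simps)
  moreover have "(d - c) * c < 0"
    using assms by (simp add: mult_less_0_iff)
  ultimately show False
    by (metis not_less zero_le_power2)
qed

section \<open>Lambda lengths\<close>

text \<open>For tangent horocycles the distance is \<open>0\<close>, so that the negative sign of the signed distance
  has no effect; this is why disjointness is only asked for when \<open>l \<noteq> 0\<close>.\<close>

lemma lambda_length_eqI:
  assumes "0 < d" "0 < e"
    and "horocycle x d \<inter> geodesic x y = {u}" "horocycle y e \<inter> geodesic x y = {v}"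
    and l: "hyp_dist u v = l"
    and disj: "l \<noteq> 0 \<Longrightarrow> horocycle x d \<inter> horocycle y e = {}"
  shows "lambda_length (horocycle x d) (horocycle y e) = exp (l / 2)"
proof -
  have "signed_dist (horocycle x d) (horocycle y e) = l"
    unfolding signed_dist_def Let_def horocycle_center_horocycle[OF assms(1)]
      horocycle_center_horocycle[OF assms(2)] assms(3,4)
    using l disj by (cases "l = 0") simp_all
  then show ?thesis by (simp add: lambda_length_def)
qed

text \<open>With \<open>m\<close> the claimed value, the distance is \<open>2 * ln m\<close>.  The hypothesis on \<open>d * e\<close> says
  \<open>m \<ge> 1\<close>, and \<open>m > 1\<close> forces the horocycles to be disjoint.\<close>

lemma lambda_length_Fin_Fin:
  assumes "x \<noteq> y" "0 < d" "0 < e" "d * e \<le> (x - y)\<^sup>2"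
  shows "lambda_length (horocycle (Fin x) d) (horocycle (Fin y) e) = \<bar>x - y\<bar> / sqrt (d * e)"
proof -
  define m where "m = \<bar>x - y\<bar> / sqrt (d * e)"
  have "sqrt (d * e) \<le> \<bar>x - y\<bar>"
    using real_sqrt_le_mono[OF assms(4)] by simp
  then have m: "1 \<le> m"
    using assms by (simp add: m_def)
  have ln_m: "2 * ln m = ln \<bar>(y - x) / e\<bar> - ln \<bar>d / (y - x)\<bar>"
    using assms by (simp add: m_def ln_div ln_mult ln_sqrt abs_minus_commute add_divide_distrib)
  have "lambda_length (horocycle (Fin x) d) (horocycle (Fin y) e) = exp (2 * ln m / 2)"
  proof (rule lambda_length_eqI[OF assms(2,3) horocycle_Int_semicircle[OF assms(1-3)]])
    have "hyp_dist (semicircle_point x y (d / (y - x))) (semicircle_point x y ((y - x) / e))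
        = \<bar>2 * ln m\<bar>"
      unfolding ln_m using assms
      by (intro hyp_dist_semicircle) (auto simp: zero_less_mult_iff zero_less_divide_iff)
    then show "hyp_dist (semicircle_point x y (d / (y - x))) (semicircle_point x y ((y - x) / e))
        = 2 * ln m"
      using m by simp
    assume "2 * ln m \<noteq> 0"
    then have "m \<noteq> 1" by auto
    then have "sqrt (d * e) \<noteq> \<bar>x - y\<bar>"
      using assms by (auto simp: m_def)
    then have "d * e \<noteq> (x - y)\<^sup>2" by auto
    then show "horocycle (Fin x) d \<inter> horocycle (Fin y) e = {}"
      using assms by (intro disjoint_horocycles_Fin) auto
  qed
  then show ?thesis
    using m by (simp add: m_def)
qed

lemma lambda_length_Fin_Infty:
  assumes "0 < d" "d \<le> c"
  shows "lambda_length (horocycle (Fin x) d) (horocycle Infty c) = sqrt (c / d)"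
    and "lambda_length (horocycle Infty c) (horocycle (Fin x) d) = sqrt (c / d)"
proof -
  have c: "0 < c" using assms by simp
  have dist: "hyp_dist (Complex x d) (Complex x c) = ln c - ln d"
      "hyp_dist (Complex x c) (Complex x d) = ln c - ln d"
    using assms c by (simp_all add: hyp_dist_vertical)
  have disj: "horocycle (Fin x) d \<inter> horocycle Infty c = {}" if "ln c - ln d \<noteq> 0"
    using that assms by (intro disjoint_horocycles_Infty) (auto simp: less_le)
  have "(ln c - ln d) / 2 = ln (sqrt (c / d))"
    using assms c by (simp add: ln_div ln_sqrt)
  then have exp: "exp ((ln c - ln d) / 2) = sqrt (c / d)"
    using assms c by simp
  note int = horocycle_Int_vertical[OF assms(1) c]
  show "lambda_length (horocycle (Fin x) d) (horocycle Infty c) = sqrt (c / d)"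
    unfolding exp[symmetric]
    by (rule lambda_length_eqI[OF assms(1) c int dist(1) disj])
  have "geodesic Infty (Fin x) = geodesic (Fin x) Infty" by simp
  with int have "horocycle Infty c \<inter> geodesic Infty (Fin x) = {Complex x c}"
      "horocycle (Fin x) d \<inter> geodesic Infty (Fin x) = {Complex x d}"
    by simp_all
  from lambda_length_eqI[OF c assms(1) this dist(2)] disj
  show "lambda_length (horocycle Infty c) (horocycle (Fin x) d) = sqrt (c / d)"
    unfolding exp[symmetric] by blast
qed

section \<open>The Farey decoration\<close>

text \<open>The reduced form of \<open>p / q\<close> has denominator \<open>\<bar>q\<bar>\<close>, and only its square enters the decoration, so
  a negative \<open>q\<close> does no harm.\<close>

lemma farey_decoration_frac_point:
  assumes "coprime p q"
  shows "farey_decoration (frac_point p q) =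
    (if q = 0 then horocycle Infty 1 else horocycle (Fin (of_int p / of_int q)) (1 / (of_int q)\<^sup>2))"
proof (cases "q = 0")
  case False
  have "(snd (quotient_of (of_int p / of_int q)))\<^sup>2 = q\<^sup>2"
    using assms False
    by (simp flip: Fract_of_int_quotient add: quotient_of_Fract Rat.normalize_def Let_def coprime_iff_gcd_eq_1)
  then have "(of_int (snd (quotient_of (of_int p / of_int q))))\<^sup>2 = (of_int q :: real)\<^sup>2"
    by (metis of_int_power)
  then show ?thesis
    using False by (simp add: frac_point_def of_rat_divide del: horocycle.simps)
qed (simp add: frac_point_def)

theorem corollary2p2:
  fixes p q r s :: int
  assumes "coprime p q"
    and "coprime r s"
    and "frac_point p q \<noteq> frac_point r s"
  shows "lambda_length (farey_decoration (frac_point p q)) (farey_decoration (frac_point r s))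
           = of_int \<bar>p * s - q * r\<bar>"
proof -
  have unit: "\<bar>a\<bar> = 1" if "coprime a 0" for a :: int
    using that by simp
  have diam: "1 / (real_of_int a)\<^sup>2 \<le> 1" "sqrt (1 / (1 / (real_of_int a)\<^sup>2)) = of_int \<bar>a\<bar>" "0 < 1 / (real_of_int a)\<^sup>2"
    if "a \<noteq> 0" for a :: int
  proof -
    have "1 \<le> a\<^sup>2" using that by (simp add: int_one_le_iff_zero_less)
    then have "1 \<le> (real_of_int a)\<^sup>2" by (metis of_int_1_le_iff of_int_power)
    with that show "1 / (real_of_int a)\<^sup>2 \<le> 1" "0 < 1 / (real_of_int a)\<^sup>2" by simp_all
  qed simp
  note F = farey_decoration_frac_point[OF assms(1)] farey_decoration_frac_point[OF assms(2)]
  consider "q = 0" "s = 0" | "q \<noteq> 0" "s = 0" | "q = 0" "s \<noteq> 0" | "q \<noteq> 0" "s \<noteq> 0" by blast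
  then show ?thesis
  proof cases
    case 1
    with assms(3) show ?thesis by (simp add: frac_point_def)
  next
    case 2
    then show ?thesis
      using unit[of r] assms(2) lambda_length_Fin_Infty(1)[OF diam(3,1), of q] diam(2)[of q]
      unfolding F by (simp add: abs_mult del: horocycle.simps)
  next
    case 3
    then show ?thesis
      using unit[of p] assms(1) lambda_length_Fin_Infty(2)[OF diam(3,1), of s] diam(2)[of s]
      unfolding F by (simp add: abs_mult del: horocycle.simps)
  next
    case 4
    define x y d e :: real where "x = of_int p / of_int q" and "y = of_int r / of_int s"
      and "d = 1 / (of_int q)\<^sup>2" and "e = 1 / (of_int s)\<^sup>2"
    \<comment> \<open>Distinct fractions have determinant at least \<open>1\<close> in absolute value, which is the condition
      for the horocycles not to overlap.\<close>
    have "p * s - q * r \<noteq> 0"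
    proof
      assume "p * s - q * r = 0"
      then have "(of_int (p * s) :: rat) = of_int (q * r)" by simp
      with 4 assms(3) show False
        by (simp add: frac_point_def frac_eq_eq mult.commute)
    qed
    then have "1 \<le> (p * s - q * r)\<^sup>2" by (simp add: int_one_le_iff_zero_less)
    then have one: "1 \<le> (real_of_int (p * s - q * r))\<^sup>2"
      by (metis of_int_1_le_iff of_int_power)
    have diff: "x - y = of_int (p * s - q * r) / of_int (q * s)"
      using 4 by (simp add: x_def y_def field_simps)
    have de: "d * e = 1 / (of_int (q * s))\<^sup>2"
      by (simp add: d_def e_def power_mult_distrib)
    have "d * e \<le> (x - y)\<^sup>2"
      unfolding de diff power_divide using one by (intro divide_right_mono) auto
    moreover have "x \<noteq> y"
    proof -
      have "x - y \<noteq> 0"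
        unfolding diff using 4 \<open>p * s - q * r \<noteq> 0\<close> by (simp del: of_int_mult of_int_diff)
      then show ?thesis by simp
    qed
    moreover have "0 < d" "0 < e"
      using 4 by (simp_all add: d_def e_def)
    ultimately have "lambda_length (horocycle (Fin x) d) (horocycle (Fin y) e) = \<bar>x - y\<bar> / sqrt (d * e)"
      by (intro lambda_length_Fin_Fin)
    also have "\<dots> = of_int \<bar>p * s - q * r\<bar>"
      unfolding de diff using 4 by (simp add: real_sqrt_divide abs_divide del: of_int_mult of_int_diff)
    finally show ?thesis
      unfolding F x_def y_def d_def e_def using 4 by (simp only: if_False)
  qed
qed

end
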